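(* Let $A$ be an arbitrary monoid and let $B$ be a finite monoid or a group. Then $A\Diamond_v B$ is regular if and only if all of the following conditions hold: (i) $A$ and $B$ are regular; (ii) for every $x\in B$ and $f\in A^{\oplus B}$ there exists $e\in B$ with $e^2=e$ such that $(x)f\in A\,(xe)f$; (iii) for every $(f,P,b)\in A\Diamond_v B$, either $$P=P_1b=\bigcup_{(f_1,b_1)\in P_1}\{(f_1,\,b_1b)\}$$ for some $P_1\subseteq A^{\oplus B}\times B$, or $$P=P_1bd=\bigcup_{(f_1,b_1)\in P_1}\{(f_1,\,b_1bd)\}$$ for some $P_1\subseteq A^{\oplus B}\times B$ and $d\in b^{-1}$.
   Context: For a monoid $M$ and $a\in M$, write $a^{-1}=\{b\in M : aba=a \text{ and } bab=b\}$ for the set of (semigroup) inverses of $a$ in $M$. The monoid $M$ is called regular if for every $a\in M$ there exists $b\in M$ with $aba=a$ and $bab=b$, i.e. $a^{-1}\neq\emptyset$ for every $a\in M$. Functions are written on the right of their arguments: $(x)f$ denotes the value of $f$ at $x$. For monoids $A,B$, $A^{\oplus B}$ is the set of all functions $f:B\to A$ with finite support, i.e. $(x)f=1_A$ for all but finitely many $x\in B$, with pointwise multiplication. For $b\in B$ and $g\in A^{\oplus B}$, the function ${}^{b}g:B\to A$ is defined by $(x)\,{}^{b}g=(xb)g$ for $x\in B$ (when $B$ is finite or a group, ${}^{b}g$ again has finite support). For $y\in B$ and $f\in A^{\oplus B}$, $A\,(y)f=\{a\cdot (y)f : a\in A\}$ denotes the principal left ideal of $A$ generated by $(y)f$. For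 $P\subseteq A^{\oplus B}\times B$ and $b\in B$ put $Pb=\{(f,db) : (f,d)\in P\}$. The new version of the Schützenberger product of $A$ by $B$, denoted $A\Diamond_v B$, is the set $A^{\oplus B}\times\mathcal{P}(A^{\oplus B}\times B)\times B$, where $\mathcal{P}$ denotes the power set, with multiplication $$(f,P_1,b_1)(g,P_2,b_2)=(f\;{}^{b_1}g,\;P_1b_2\cup P_2,\;b_1b_2).$$ It is a monoid with identity $(\overline{1},\emptyset,1_B)$, where $(x)\overline{1}=1_A$ for all $x\in B$. *)

theory Defs
  imports "HOL-Algebra.Group"
begin

definition inverses :: "('a, 'm) monoid_scheme \<Rightarrow> 'a \<Rightarrow> 'a set"
  where "inverses M a =
    {b \<in> carrier M. a \<otimes>\<^bsub>M\<^esub> b \<otimes>\<^bsub>M\<^esub> a = a \<and> b \<otimes>\<^bsub>M\<^esub> a \<otimes>\<^bsub>M\<^esub> b = b}"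

definition regular_monoid :: "('a, 'm) monoid_scheme \<Rightarrow> bool"
  where "regular_monoid M \<longleftrightarrow> (\<forall>a \<in> carrier M. inverses M a \<noteq> {})"

definition principal_left_ideal :: "('a, 'm) monoid_scheme \<Rightarrow> 'a \<Rightarrow> 'a set"
  where "principal_left_ideal M y = {a \<otimes>\<^bsub>M\<^esub> y | a. a \<in> carrier M}"

text \<open>
  Functions from \<open>B\<close> to \<open>A\<close> are extensional functions on \<open>carrier B\<close>, so that equality of
  HOL functions is equality on \<open>carrier B\<close>.
\<close>

definition fin_supp_funs ::
    "('a, 'm) monoid_scheme \<Rightarrow> ('b, 'n) monoid_scheme \<Rightarrow> ('b \<Rightarrow> 'a) set"
  where "fin_supp_funs A B =
    {f \<in> carrier B \<rightarrow>\<^sub>E carrier A. finite {x \<in> carrier B. f x \<noteq> \<one>\<^bsub>A\<^esub>}}"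

definition translate :: "('b, 'n) monoid_scheme \<Rightarrow> 'b \<Rightarrow> ('b \<Rightarrow> 'a) \<Rightarrow> 'b \<Rightarrow> 'a"
  where "translate B b g = (\<lambda>x \<in> carrier B. g (x \<otimes>\<^bsub>B\<^esub> b))"

definition pmult ::
    "('a, 'm) monoid_scheme \<Rightarrow> ('b, 'n) monoid_scheme \<Rightarrow> ('b \<Rightarrow> 'a) \<Rightarrow> ('b \<Rightarrow> 'a) \<Rightarrow> 'b \<Rightarrow> 'a"
  where "pmult A B f g = (\<lambda>x \<in> carrier B. f x \<otimes>\<^bsub>A\<^esub> g x)"

definition rshift :: "('b, 'n) monoid_scheme \<Rightarrow> ('f \<times> 'b) set \<Rightarrow> 'b \<Rightarrow> ('f \<times> 'b) set"
  where "rshift B P b = {(f, d \<otimes>\<^bsub>B\<^esub> b) | f d. (f, d) \<in> P}"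

definition schutz_v ::
    "('a, 'm) monoid_scheme \<Rightarrow> ('b, 'n) monoid_scheme \<Rightarrow>
      (('b \<Rightarrow> 'a) \<times> (('b \<Rightarrow> 'a) \<times> 'b) set \<times> 'b) monoid"
  where "schutz_v A B =
    \<lparr>carrier = fin_supp_funs A B \<times> Pow (fin_supp_funs A B \<times> carrier B) \<times> carrier B,
     monoid.mult = (\<lambda>(f, P\<^sub>1, b\<^sub>1) (g, P\<^sub>2, b\<^sub>2).
       (pmult A B f (translate B b\<^sub>1 g), rshift B P\<^sub>1 b\<^sub>2 \<union> P\<^sub>2, b\<^sub>1 \<otimes>\<^bsub>B\<^esub> b\<^sub>2)),
     one = ((\<lambda>x \<in> carrier B. \<one>\<^bsub>A\<^esub>), {}, \<one>\<^bsub>B\<^esub>)\<rparr>"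

lemma translate_fin_supp:
  assumes "monoid A" "monoid B" "finite (carrier B) \<or> group B"
    and g: "g \<in> fin_supp_funs A B" and b: "b \<in> carrier B"
  shows "translate B b g \<in> fin_supp_funs A B"
proof -
  interpret B: monoid B by fact
  have "finite {x \<in> carrier B. g (x \<otimes>\<^bsub>B\<^esub> b) \<noteq> \<one>\<^bsub>A\<^esub>}"
  proof (cases "finite (carrier B)")
    case False
    then interpret Bg: group B using assms by blast
    have "inj_on (\<lambda>x. x \<otimes>\<^bsub>B\<^esub> b) {x \<in> carrier B. g (x \<otimes>\<^bsub>B\<^esub> b) \<noteq> \<one>\<^bsub>A\<^esub>}"
      using b by (auto simp: inj_on_def)
    moreover have "(\<lambda>x. x \<otimes>\<^bsub>B\<^esub> b) ` {x \<in> carrier B. g (x \<otimes>\<^bsub>B\<^esub> b) \<noteq> \<one>\<^bsub>A\<^esub>}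
        \<subseteq> {x \<in> carrier B. g x \<noteq> \<one>\<^bsub>A\<^esub>}"
      using b by auto
    moreover have "finite {x \<in> carrier B. g x \<noteq> \<one>\<^bsub>A\<^esub>}"
      using g by (simp add: fin_supp_funs_def)
    ultimately show ?thesis by (meson finite_imageD finite_subset)
  qed simp
  moreover have "{x \<in> carrier B. translate B b g x \<noteq> \<one>\<^bsub>A\<^esub>} =
      {x \<in> carrier B. g (x \<otimes>\<^bsub>B\<^esub> b) \<noteq> \<one>\<^bsub>A\<^esub>}"
    by (auto simp: translate_def)
  moreover have "translate B b g \<in> carrier B \<rightarrow>\<^sub>E carrier A"
    using g b by (auto simp: translate_def fin_supp_funs_def PiE_iff)
  ultimately show ?thesis by (simp add: fin_supp_funs_def)
qed

lemma pmult_fin_supp: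
  assumes "monoid A" and f: "f \<in> fin_supp_funs A B" and g: "g \<in> fin_supp_funs A B"
  shows "pmult A B f g \<in> fin_supp_funs A B"
proof -
  interpret A: monoid A by fact
  have "{x \<in> carrier B. pmult A B f g x \<noteq> \<one>\<^bsub>A\<^esub>}
      \<subseteq> {x \<in> carrier B. f x \<noteq> \<one>\<^bsub>A\<^esub>} \<union> {x \<in> carrier B. g x \<noteq> \<one>\<^bsub>A\<^esub>}"
    by (auto simp: pmult_def)
  then have "finite {x \<in> carrier B. pmult A B f g x \<noteq> \<one>\<^bsub>A\<^esub>}"
    using f g by (auto simp: fin_supp_funs_def intro: finite_subset)
  then show ?thesis
    using f g by (auto simp: fin_supp_funs_def pmult_def PiE_iff)
qed

lemma monoid_schutz_v:
  assumes "monoid A" "monoid B" and fin: "finite (carrier B) \<or> group B"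
  shows "monoid (schutz_v A B)"
proof -
  interpret A: monoid A by fact
  interpret B: monoid B by fact
  note cl = translate_fin_supp[OF assms] pmult_fin_supp[OF assms(1)]
  have one: "(\<lambda>x \<in> carrier B. \<one>\<^bsub>A\<^esub>) \<in> fin_supp_funs A B"
    by (auto simp: fin_supp_funs_def cong: conj_cong)
  have ext: "f \<in> extensional (carrier B)" "x \<in> carrier B \<Longrightarrow> f x \<in> carrier A"
    if "f \<in> fin_supp_funs A B" for f x
    using that by (auto simp: fin_supp_funs_def PiE_iff)
  have sh: "rshift B P b \<subseteq> fin_supp_funs A B \<times> carrier B"
    if "P \<subseteq> fin_supp_funs A B \<times> carrier B" "b \<in> carrier B" for P b
    using that by (auto simp: rshift_def)
  have shc: "rshift B (rshift B P b) c = rshift B P (b \<otimes>\<^bsub>B\<^esub> c)"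
    if "P \<subseteq> fin_supp_funs A B \<times> carrier B" "b \<in> carrier B" "c \<in> carrier B" for P b c
    using that unfolding rshift_def by (auto simp: B.m_assoc) (force simp: B.m_assoc)+
  have sh1: "rshift B P \<one>\<^bsub>B\<^esub> = P" if "P \<subseteq> fin_supp_funs A B \<times> carrier B" for P
    using that unfolding rshift_def by auto (force)+
  have shU: "rshift B (P \<union> Q) b = rshift B P b \<union> rshift B Q b" for P Q b
    by (auto simp: rshift_def)
  have fa: "pmult A B (pmult A B f (translate B b g)) (translate B (b \<otimes>\<^bsub>B\<^esub> c) h) =
      pmult A B f (translate B b (pmult A B g (translate B c h)))"
    if "f \<in> fin_supp_funs A B" "g \<in> fin_supp_funs A B" "h \<in> fin_supp_funs A B"
      "b \<in> carrier B" "c \<in> carrier B" for f g h b c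
    using that
    by (auto simp: pmult_def translate_def fun_eq_iff restrict_def ext A.m_assoc B.m_assoc)
  have fl: "pmult A B (\<lambda>x \<in> carrier B. \<one>\<^bsub>A\<^esub>) (translate B \<one>\<^bsub>B\<^esub> f) = f"
    and fr: "b \<in> carrier B \<Longrightarrow> pmult A B f (translate B b (\<lambda>x \<in> carrier B. \<one>\<^bsub>A\<^esub>)) = f"
    if "f \<in> fin_supp_funs A B" for f b
    using ext[OF that]
    by (auto simp: pmult_def translate_def fun_eq_iff restrict_def extensional_def)
  have [simp]: "rshift B {} b = {}" for b
    by (simp add: rshift_def)
  show ?thesis
    by (rule monoidI)
      (auto simp: schutz_v_def one cl fa fl fr shU shc sh1 B.m_assoc dest: subsetD[OF sh, rotated 2])
qed

end

(*
  Both sides say that A is regular and B is a group. Indeed (f, P, b) has inverses only if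
  P c b is contained in P for some inverse c of b; for P = {(1, 1)} this gives c b = 1. In condition
  (iii) the same P gives c b = 1, or c b d = 1 with d an inverse of b; in the latter case b d = 1, and
  one-sided inverses in a finite monoid are two-sided. Conversely, over a group B conditions (ii)
  and (iii) are trivial, and (f, P, b) has the inverse (g, P b^-1, b^-1), where g is the translate by
  b^-1 of a pointwise inverse of f.
*)
theory Submission
  imports Defs
begin

text \<open>From \<open>x \<otimes> y = \<one>\<close>, left multiplication by \<open>y\<close> is
  undone by left multiplication by \<open>x\<close>, so it is injective and, on a finite carrier,
  surjective. Hence \<open>y\<close> also has a right inverse, which must be
  \<open>x\<close>.\<close>

lemma (in monoid) finite_one_sided_inverse:
  assumes fin: "finite (carrier G)" and x: "x \<in> carrier G" and y: "y \<in> carrier G"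
    and xy: "x \<otimes> y = \<one>"
  shows "y \<otimes> x = \<one>"
proof -
  have canc: "x \<otimes> (y \<otimes> z) = z" if "z \<in> carrier G" for z
    using that x y xy by (simp flip: m_assoc)
  then have "inj_on (\<lambda>z. y \<otimes> z) (carrier G)"
    by (metis inj_onI)
  then have "(\<lambda>z. y \<otimes> z) ` carrier G = carrier G"
    using fin y by (intro endo_inj_surj) auto
  then obtain z where z: "z \<in> carrier G" "y \<otimes> z = \<one>"
    by (metis imageE one_closed)
  then show ?thesis
    using canc[OF z(1)] x by simp
qed

text \<open>This keeps supports finite: a pointwise inverse of a function has value one wherever the
  function does.\<close>

lemma (in monoid) inverses_one: "inverses G \<one> = {\<one>}"
  by (auto simp: inverses_def)

lemma (in group) inv_in_inverses:
  assumes "b \<in> carrier G"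
  shows "inv b \<in> inverses G b"
  using assms by (simp add: inverses_def)

lemma one_fin_supp:
  assumes "monoid A"
  shows "(\<lambda>x \<in> carrier B. \<one>\<^bsub>A\<^esub>) \<in> fin_supp_funs A B"
proof -
  interpret A: monoid A by fact
  show ?thesis
    by (auto simp: fin_supp_funs_def cong: conj_cong)
qed

lemma fin_supp_funs_closed:
  "f \<in> fin_supp_funs A B \<Longrightarrow> x \<in> carrier B \<Longrightarrow> f x \<in> carrier A"
  by (auto simp: fin_supp_funs_def)

lemma rshift_subset:
  assumes "monoid B" "P \<subseteq> F \<times> carrier B" "b \<in> carrier B"
  shows "rshift B P b \<subseteq> F \<times> carrier B"
proof -
  interpret B: monoid B by fact
  show ?thesis
    using assms by (auto simp: rshift_def)
qed

lemma rshift_rshift: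
  assumes "monoid B" "P \<subseteq> F \<times> carrier B" "b \<in> carrier B" "c \<in> carrier B"
  shows "rshift B (rshift B P b) c = rshift B P (b \<otimes>\<^bsub>B\<^esub> c)"
proof -
  interpret B: monoid B by fact
  show ?thesis
    using assms unfolding rshift_def by (auto simp: B.m_assoc) (force simp: B.m_assoc)+
qed

lemma rshift_one:
  assumes "monoid B" "P \<subseteq> F \<times> carrier B"
  shows "rshift B P \<one>\<^bsub>B\<^esub> = P"
proof -
  interpret B: monoid B by fact
  show ?thesis
    using assms unfolding rshift_def by auto force+
qed

text \<open>The element to test has second component a singleton, which no shift other than a
  trivial one maps into itself. Left inverses for all \<open>b\<close> are what turns the monoid
  \<open>B\<close> into a group.\<close>

lemma left_inverse_if_regular_schutz_v:
  assumes A: "monoid A" and B: "monoid B"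
    and reg: "regular_monoid (schutz_v A B)" and b: "b \<in> carrier B"
  shows "\<exists>c \<in> carrier B. c \<otimes>\<^bsub>B\<^esub> b = \<one>\<^bsub>B\<^esub>"
proof -
  interpret B: monoid B by fact
  let ?o = "\<lambda>x \<in> carrier B. \<one>\<^bsub>A\<^esub>"
  let ?s = "(?o, {(?o, \<one>\<^bsub>B\<^esub>)}, b)"
  have "?s \<in> carrier (schutz_v A B)"
    using one_fin_supp[OF A] b by (simp add: schutz_v_def)
  then obtain g Q c where inv: "(g, Q, c) \<in> inverses (schutz_v A B) ?s"
    using reg unfolding regular_monoid_def by fast
  then have c: "c \<in> carrier B"
    by (simp add: inverses_def schutz_v_def)
  \<comment> \<open>This is the second component of \<open>s t s = s\<close> for
    \<open>s = ?s\<close> and \<open>t = (g, Q, c)\<close>.\<close>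
  have "rshift B (rshift B {(?o, \<one>\<^bsub>B\<^esub>)} c \<union> Q) b \<union> {(?o, \<one>\<^bsub>B\<^esub>)} = {(?o, \<one>\<^bsub>B\<^esub>)}"
    using inv by (simp add: inverses_def schutz_v_def)
  moreover have "(?o, \<one>\<^bsub>B\<^esub> \<otimes>\<^bsub>B\<^esub> c \<otimes>\<^bsub>B\<^esub> b) \<in> rshift B (rshift B {(?o, \<one>\<^bsub>B\<^esub>)} c \<union> Q) b"
    unfolding rshift_def by blast
  ultimately have "\<one>\<^bsub>B\<^esub> \<otimes>\<^bsub>B\<^esub> c \<otimes>\<^bsub>B\<^esub> b = \<one>\<^bsub>B\<^esub>"
    by blast
  then show ?thesis
    using c by auto
qed

text \<open>The monoid \<open>A\<close> is seen through the value at one of the first component: an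
  element \<open>a\<close> is encoded as a function supported at one, with third component one so
  that translation does nothing.\<close>

lemma regular_left_factor_if_regular_schutz_v:
  assumes A: "monoid A" and B: "monoid B" and reg: "regular_monoid (schutz_v A B)"
  shows "regular_monoid A"
  unfolding regular_monoid_def
proof
  interpret A: monoid A by fact
  interpret B: monoid B by fact
  fix a assume a: "a \<in> carrier A"
  define f where "f = (\<lambda>x \<in> carrier B. if x = \<one>\<^bsub>B\<^esub> then a else \<one>\<^bsub>A\<^esub>)"
  have "finite {x \<in> carrier B. f x \<noteq> \<one>\<^bsub>A\<^esub>}"
    by (rule finite_subset[of _ "{\<one>\<^bsub>B\<^esub>}"]) (auto simp: f_def)
  then have f: "f \<in> fin_supp_funs A B"
    using a by (auto simp: fin_supp_funs_def f_def)
  then have "(f, {}, \<one>\<^bsub>B\<^esub>) \<in> carrier (schutz_v A B)"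
    by (simp add: schutz_v_def)
  then obtain g Q c where inv: "(g, Q, c) \<in> inverses (schutz_v A B) (f, {}, \<one>\<^bsub>B\<^esub>)"
    using reg unfolding regular_monoid_def by fast
  \<comment> \<open>The third component of \<open>s t s = s\<close> gives \<open>c\<close>, the only
    inverse of one.\<close>
  then have g: "g \<in> fin_supp_funs A B" and c: "c = \<one>\<^bsub>B\<^esub>"
    by (auto simp: inverses_def schutz_v_def)
  have eqs: "pmult A B (pmult A B f (translate B \<one>\<^bsub>B\<^esub> g)) (translate B \<one>\<^bsub>B\<^esub> f) = f"
    "pmult A B (pmult A B g (translate B \<one>\<^bsub>B\<^esub> f)) (translate B \<one>\<^bsub>B\<^esub> g) = g"
    using inv by (auto simp: inverses_def schutz_v_def c)
  have "a \<otimes>\<^bsub>A\<^esub> g \<one>\<^bsub>B\<^esub> \<otimes>\<^bsub>A\<^esub> a = a" "g \<one>\<^bsub>B\<^esub> \<otimes>\<^bsub>A\<^esub> a \<otimes>\<^bsub>A\<^esub> g \<one>\<^bsub>B\<^esub> = g \<one>\<^bsub>B\<^esub>"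
    using eqs[THEN fun_cong, of "\<one>\<^bsub>B\<^esub>"] by (simp_all add: pmult_def translate_def f_def)
  then have "g \<one>\<^bsub>B\<^esub> \<in> inverses A a"
    using fin_supp_funs_closed[OF g] by (simp add: inverses_def)
  then show "inverses A a \<noteq> {}"
    by blast
qed

lemma regular_schutz_v_group:
  assumes A: "monoid A" and B: "group B" and reg: "regular_monoid A"
  shows "regular_monoid (schutz_v A B)"
  unfolding regular_monoid_def
proof
  interpret A: monoid A by fact
  interpret B: group B by fact
  fix s assume "s \<in> carrier (schutz_v A B)"
  then obtain f P b where s: "s = (f, P, b)" and f: "f \<in> fin_supp_funs A B"
    and P: "P \<subseteq> fin_supp_funs A B \<times> carrier B" and b: "b \<in> carrier B"
    by (auto simp: schutz_v_def)
  define c where "c = inv\<^bsub>B\<^esub> b"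
  have c: "c \<in> carrier B" and bc: "b \<otimes>\<^bsub>B\<^esub> c = \<one>\<^bsub>B\<^esub>" and cb: "c \<otimes>\<^bsub>B\<^esub> b = \<one>\<^bsub>B\<^esub>"
    using b by (auto simp: c_def)
  have "\<forall>x \<in> carrier B. \<exists>y. y \<in> inverses A (f x)"
    using reg fin_supp_funs_closed[OF f] unfolding regular_monoid_def by blast
  then obtain h0 where h0: "\<And>x. x \<in> carrier B \<Longrightarrow> h0 x \<in> inverses A (f x)"
    by metis
  define h where "h = restrict h0 (carrier B)"
  have h: "h x \<in> carrier A" "f x \<otimes>\<^bsub>A\<^esub> h x \<otimes>\<^bsub>A\<^esub> f x = f x" "h x \<otimes>\<^bsub>A\<^esub> f x \<otimes>\<^bsub>A\<^esub> h x = h x"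
    if "x \<in> carrier B" for x
    using h0[OF that] that by (auto simp: h_def inverses_def)
  \<comment> \<open>Where \<open>f\<close> is one, the choice \<open>h0\<close> has no freedom,
    since one is its own only inverse.\<close>
  have "{x \<in> carrier B. h x \<noteq> \<one>\<^bsub>A\<^esub>} \<subseteq> {x \<in> carrier B. f x \<noteq> \<one>\<^bsub>A\<^esub>}"
    using h0 A.inverses_one by (auto simp: h_def) (metis singletonD)
  then have "finite {x \<in> carrier B. h x \<noteq> \<one>\<^bsub>A\<^esub>}"
    by (rule finite_subset) (use f in \<open>simp add: fin_supp_funs_def\<close>)
  moreover have "h \<in> carrier B \<rightarrow>\<^sub>E carrier A"
    using h(1) by (auto simp: h_def)
  ultimately have hF: "h \<in> fin_supp_funs A B"
    by (simp add: fin_supp_funs_def)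
  \<comment> \<open>Multiplying by \<open>(f, P, b)\<close> on the left translates \<open>g\<close>
    by \<open>b\<close>; the translation by \<open>c\<close> cancels this, so that \<open>f\<close>
    meets its pointwise inverse \<open>h\<close> at the same argument.\<close>
  define g where "g = translate B c h"
  have g: "g \<in> fin_supp_funs A B"
    unfolding g_def using translate_fin_supp[OF A B.is_monoid _ hF c] B by blast
  have gx: "g x = h (x \<otimes>\<^bsub>B\<^esub> c)" if "x \<in> carrier B" for x
    using that by (simp add: g_def translate_def)
  have fext: "f \<in> extensional (carrier B)" and gext: "g \<in> extensional (carrier B)"
    using f g by (auto simp: fin_supp_funs_def PiE_iff)
  have xbc: "x \<otimes>\<^bsub>B\<^esub> b \<otimes>\<^bsub>B\<^esub> c = x" if "x \<in> carrier B" for x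
    using that b c bc by (simp add: B.m_assoc)
  have fgf: "pmult A B (pmult A B f (translate B b g)) (translate B \<one>\<^bsub>B\<^esub> f) = f"
    by (rule extensionalityI[OF _ fext])
      (use b in \<open>auto simp: pmult_def translate_def gx h xbc\<close>)
  \<comment> \<open>Here all three factors at \<open>x\<close> are values at
    \<open>x \<otimes> c\<close>, so the equation is \<open>h f h = h\<close> at that point.\<close>
  have gfg: "pmult A B (pmult A B g (translate B c f)) (translate B \<one>\<^bsub>B\<^esub> g) = g"
    by (rule extensionalityI[OF _ gext])
      (use c in \<open>auto simp: pmult_def translate_def gx h\<close>)
  note shift = rshift_rshift[OF B.is_monoid P] rshift_one[OF B.is_monoid P]
  have "rshift B P c \<subseteq> fin_supp_funs A B \<times> carrier B"
    by (rule rshift_subset[OF B.is_monoid P c])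
  \<comment> \<open>Since \<open>b\<close> and \<open>c\<close> are inverse to each other, the
    second components of the triple products are unions of copies of \<open>P\<close>, respectively
    of \<open>P\<close> shifted by \<open>c\<close>.\<close>
  then have "(g, rshift B P c, c) \<in> inverses (schutz_v A B) (f, P, b)"
    using f g P b c
    by (simp add: inverses_def schutz_v_def bc cb fgf gfg shift)
  then show "inverses (schutz_v A B) s \<noteq> {}"
    unfolding s by blast
qed

text \<open>Both directions of the theorem pass through this characterization, which replaces
  regularity of the product by conditions on the two factors.\<close>

lemma regular_schutz_v_iff:
  assumes A: "monoid A" and B: "monoid B"
  shows "regular_monoid (schutz_v A B) \<longleftrightarrow> regular_monoid A \<and> group B"
  using monoid.group_l_invI[OF B] left_inverse_if_regular_schutz_v[OF A B]
    regular_left_factor_if_regular_schutz_v[OF A B] regular_schutz_v_group[OF A]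
  by blast

lemma group_if_rshift_condition:
  fixes A :: "('a, 'm) monoid_scheme" and B :: "('b, 'n) monoid_scheme"
  assumes A: "monoid A" and B: "monoid B" and fin: "finite (carrier B)"
    and shift: "\<And>b P. b \<in> carrier B \<Longrightarrow> P \<subseteq> fin_supp_funs A B \<times> carrier B \<Longrightarrow>
      (\<exists>P\<^sub>1 \<subseteq> fin_supp_funs A B \<times> carrier B. P = rshift B P\<^sub>1 b) \<or>
      (\<exists>P\<^sub>1 \<subseteq> fin_supp_funs A B \<times> carrier B. \<exists>d \<in> inverses B b.
        P = rshift B P\<^sub>1 (b \<otimes>\<^bsub>B\<^esub> d))"
  shows "group B"
proof -
  interpret B: monoid B by fact
  let ?o = "\<lambda>x \<in> carrier B. \<one>\<^bsub>A\<^esub>"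
  \<comment> \<open>Both alternatives of the shift condition have this shape, with \<open>y\<close>
    equal to \<open>b\<close> or to \<open>b \<otimes> d\<close>.\<close>
  have divides_one: "\<exists>c \<in> carrier B. c \<otimes>\<^bsub>B\<^esub> y = \<one>\<^bsub>B\<^esub>"
    if "Q \<subseteq> fin_supp_funs A B \<times> carrier B" "{(?o, \<one>\<^bsub>B\<^esub>)} = rshift B Q y" for Q y
  proof -
    have "(?o, \<one>\<^bsub>B\<^esub>) \<in> rshift B Q y"
      using that(2) by blast
    then obtain c where "(?o, c) \<in> Q" "\<one>\<^bsub>B\<^esub> = c \<otimes>\<^bsub>B\<^esub> y"
      unfolding rshift_def by blast
    then show ?thesis
      using that(1) by force
  qed
  show ?thesis
  proof (rule B.group_l_invI)
    fix b assume b: "b \<in> carrier B"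
    have "{(?o, \<one>\<^bsub>B\<^esub>)} \<subseteq> fin_supp_funs A B \<times> carrier B"
      using one_fin_supp[OF A] by simp
    from shift[OF b this] consider
        "\<exists>c \<in> carrier B. c \<otimes>\<^bsub>B\<^esub> b = \<one>\<^bsub>B\<^esub>"
      | d where "d \<in> inverses B b" "\<exists>c \<in> carrier B. c \<otimes>\<^bsub>B\<^esub> (b \<otimes>\<^bsub>B\<^esub> d) = \<one>\<^bsub>B\<^esub>"
      by (elim disjE exE conjE bexE) (use divides_one in blast)+
    then show "\<exists>c \<in> carrier B. c \<otimes>\<^bsub>B\<^esub> b = \<one>\<^bsub>B\<^esub>"
    proof cases
      case 2
      then obtain c where c: "c \<in> carrier B" "c \<otimes>\<^bsub>B\<^esub> (b \<otimes>\<^bsub>B\<^esub> d) = \<one>\<^bsub>B\<^esub>"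
        by blast
      have d: "d \<in> carrier B" "d \<otimes>\<^bsub>B\<^esub> b \<otimes>\<^bsub>B\<^esub> d = d"
        using 2(1) by (auto simp: inverses_def)
      \<comment> \<open>The element \<open>b \<otimes> d\<close> is idempotent, because
        \<open>d\<close> is an inverse of \<open>b\<close>, and an idempotent with a left inverse
        \<open>c\<close> equals one.\<close>
      have "b \<otimes>\<^bsub>B\<^esub> d = c \<otimes>\<^bsub>B\<^esub> (b \<otimes>\<^bsub>B\<^esub> d) \<otimes>\<^bsub>B\<^esub> (b \<otimes>\<^bsub>B\<^esub> d)"
        using b c d by simp
      also have "\<dots> = c \<otimes>\<^bsub>B\<^esub> (b \<otimes>\<^bsub>B\<^esub> (d \<otimes>\<^bsub>B\<^esub> b \<otimes>\<^bsub>B\<^esub> d))"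
        using b c(1) d(1) by (simp add: B.m_assoc)
      also have "\<dots> = \<one>\<^bsub>B\<^esub>"
        using c d by simp
      finally show ?thesis
        \<comment> \<open>So far \<open>d\<close> is a right inverse of \<open>b\<close>; finiteness
          makes it the left inverse that is wanted.\<close>
        using B.finite_one_sided_inverse[OF fin b d(1)] d(1) by blast
    qed
  qed
qed

theorem theorem2p2:
  fixes A :: "('a, 'm) monoid_scheme" and B :: "('b, 'n) monoid_scheme"
  assumes "monoid A" and "monoid B"
    and "finite (carrier B) \<or> group B"
  shows "regular_monoid (schutz_v A B) \<longleftrightarrow>
    (regular_monoid A \<and> regular_monoid B) \<and>
    (\<forall>x \<in> carrier B. \<forall>f \<in> fin_supp_funs A B.
      \<exists>e \<in> carrier B. e \<otimes>\<^bsub>B\<^esub> e = e \<and>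
        f x \<in> principal_left_ideal A (f (x \<otimes>\<^bsub>B\<^esub> e))) \<and>
    (\<forall>(f, P, b) \<in> carrier (schutz_v A B).
      (\<exists>P\<^sub>1 \<subseteq> fin_supp_funs A B \<times> carrier B. P = rshift B P\<^sub>1 b) \<or>
      (\<exists>P\<^sub>1 \<subseteq> fin_supp_funs A B \<times> carrier B. \<exists>d \<in> inverses B b.
        P = rshift B P\<^sub>1 (b \<otimes>\<^bsub>B\<^esub> d)))" (is "?L \<longleftrightarrow> ?R")
proof
  assume "regular_monoid (schutz_v A B)"
  then have A: "regular_monoid A" and B: "group B"
    using regular_schutz_v_iff[OF assms(1,2)] by auto
  interpret A: monoid A by fact
  interpret B: group B by fact
  have "regular_monoid B"
    unfolding regular_monoid_def using B.inv_in_inverses by blast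
  moreover have "\<exists>e \<in> carrier B. e \<otimes>\<^bsub>B\<^esub> e = e \<and> f x \<in> principal_left_ideal A (f (x \<otimes>\<^bsub>B\<^esub> e))"
    if x: "x \<in> carrier B" and f: "f \<in> fin_supp_funs A B" for x f
  proof -
    \<comment> \<open>The idempotent for condition (ii) is the identity of \<open>B\<close>.\<close>
    have "f x = \<one>\<^bsub>A\<^esub> \<otimes>\<^bsub>A\<^esub> f (x \<otimes>\<^bsub>B\<^esub> \<one>\<^bsub>B\<^esub>)"
      using x fin_supp_funs_closed[OF f x] by simp
    then have "f x \<in> principal_left_ideal A (f (x \<otimes>\<^bsub>B\<^esub> \<one>\<^bsub>B\<^esub>))"
      unfolding principal_left_ideal_def by blast
    then show ?thesis
      by (intro bexI[of _ "\<one>\<^bsub>B\<^esub>"]) auto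
  qed
  moreover have "\<exists>P\<^sub>1 \<subseteq> fin_supp_funs A B \<times> carrier B. P = rshift B P\<^sub>1 b"
    if P: "P \<subseteq> fin_supp_funs A B \<times> carrier B" and b: "b \<in> carrier B" for P b
  \<comment> \<open>In a group the first alternative of (iii) always holds: shift \<open>P\<close>
    back by the inverse of \<open>b\<close>.\<close>
  proof (intro exI conjI)
    show "rshift B P (inv\<^bsub>B\<^esub> b) \<subseteq> fin_supp_funs A B \<times> carrier B"
      by (rule rshift_subset[OF assms(2) P]) (simp add: b)
    show "P = rshift B (rshift B P (inv\<^bsub>B\<^esub> b)) b"
      using b by (simp add: rshift_rshift[OF assms(2) P] rshift_one[OF assms(2) P])
  qed
  ultimately show ?R
    using A by (auto simp: schutz_v_def)
next
  assume R: ?R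
  have "group B"
  proof (cases "group B")
    case False
    then have "finite (carrier B)"
      using assms(3) by blast
    then show ?thesis
    proof (rule group_if_rshift_condition[OF assms(1,2)], goal_cases)
      case (1 b P)
      \<comment> \<open>Condition (iii) ranges over triples, so \<open>P\<close> and
        \<open>b\<close> are completed to one by the constant function one.\<close>
      have "((\<lambda>x \<in> carrier B. \<one>\<^bsub>A\<^esub>), P, b) \<in> carrier (schutz_v A B)"
        using 1 one_fin_supp[OF assms(1)] by (simp add: schutz_v_def)
      then show ?case
        using R by blast
    qed
  qed
  then show ?L
    using R regular_schutz_v_iff[OF assms(1,2)] by blast
qed

end
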